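(* Let $\mathscr{A}$ be the set of overpartitions such that (1) only odd parts may be overlined, and (2) the difference between any two parts is at least $4$, and is at least $5$ if the larger of the two parts is overlined or divisible by $4$. For a set $S$ of (possibly overlined) parts, let $\mathscr{A}_S$ be the subset of $\mathscr{A}$ of overpartitions having no part from $S$. Write \[ Q(n_1,n_2,n_3,n_4)=4\tbinom{n_1}{2}+6\tbinom{n_2}{2}+4\tbinom{n_3}{2}+8\tbinom{n_4}{2}+4n_1n_2+4n_1n_3+4n_1n_4+4n_2n_3+4n_2n_4+4n_3n_4, \] and for integers $b_1,b_2,b_3,b_4$ let \[ S(b_1,b_2,b_3,b_4)=\sum_{n_1,n_2,n_3,n_4\ge 0}\frac{x^{n_1+n_2+n_3+n_4}y_1^{n_3}y_2^{n_4}z^{n_2}q^{b_1n_1+b_2n_2+b_3n_3+b_4n_4+Q(n_1,n_2,n_3,n_4)}}{(q^2;q^2)_{n_1}(q^2;q^2)_{n_2}(q^4;q^4)_{n_3}(q^4;q^4)_{n_4}}. \] Writing $W(\lambda)=x^{\sharp(\lambda)}y_1^{\sharp_{2,4}(\lambda)}y_2^{\sharp_{0,4}(\lambda)}z^{\mathsf{O}(\lambda)}q^{|\lambda|}$, we have, as formal power series, \begin{align*} \sum_{\lambda\in\mathscr{A}}W(\lambda)&=S(1,1,2,4),\\ \sum_{\lambda\in\mathscr{A}_{\{\overline{1}\}}}W(\lambda)&=S(1,3,2,4),\\ \sum_{\lambda\in\mathscr{A}_{\{1,\overline{1}\}}}W(\lambda)&=S(3,3,2,4),\\ \sum_{\lambda\in\mathscr{A}_{\{1,\overline{1},2,\overline{3}\}}}W(\lambda)&=S(3,5,6,4).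 \end{align*}
   Context: An overpartition is a partition in which the first occurrence of each distinct part value may be overlined. For an overpartition $\lambda$: $|\lambda|$ is the sum of its parts, $\sharp(\lambda)$ the number of parts, $\sharp_{a,M}(\lambda)$ the number of parts (overlined or not) congruent to $a$ modulo $M$, and $\mathsf{O}(\lambda)$ the number of overlined parts. In $\mathscr{A}_S$, a non-overlined part $1$ and an overlined part $\overline{1}$ are distinct elements of $S$ (e.g. $\mathscr{A}_{\{\overline{1}\}}$ forbids $\overline{1}$ but allows $1$). $(A;q)_n:=\prod_{k=0}^{n-1}(1-Aq^k)$. *)

theory Defs
  imports "HOL-Analysis.Analysis"
begin

section \<open>Overpartitions\<close>

text \<open>A part is a positive integer together with a flag telling whether it is overlined.\<close>

type_synonym part = "nat \<times> bool"

abbreviation plain :: "nat \<Rightarrow> part" where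
  "plain k \<equiv> (k, False)"

abbreviation overl :: "nat \<Rightarrow> part" where
  "overl k \<equiv> (k, True)"

abbreviation psize :: "part \<Rightarrow> nat" where
  "psize \<equiv> fst"

abbreviation overlined :: "part \<Rightarrow> bool" where
  "overlined \<equiv> snd"

text \<open>Overpartitions are the lists of parts, in weakly decreasing order of size, in which only the
  first occurrence of each part size may be overlined. The list is determined by the overpartition.\<close>

definition overpartition :: "part list \<Rightarrow> bool" where
  "overpartition l \<longleftrightarrow>
     (\<forall>p\<in>set l. psize p > 0) \<and>
     (\<forall>i j. i < j \<and> j < length l \<longrightarrow> psize (l ! i) \<ge> psize (l ! j)) \<and>
     (\<forall>i j. i < j \<and> j < length l \<and> psize (l ! i) = psize (l ! j) \<longrightarrow> \<not> overlined (l ! j))"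

definition weight_of :: "part list \<Rightarrow> nat" where
  "weight_of l = (\<Sum>p\<leftarrow>l. psize p)"

definition num_parts :: "part list \<Rightarrow> nat" where
  "num_parts l = length l"

definition num_parts_cong :: "nat \<Rightarrow> nat \<Rightarrow> part list \<Rightarrow> nat" where
  "num_parts_cong a M l = length (filter (\<lambda>p. psize p mod M = a mod M) l)"

definition num_overlined :: "part list \<Rightarrow> nat" where
  "num_overlined l = length (filter overlined l)"

text \<open>For \<open>i < j\<close> the part \<open>l ! i\<close> is the larger one: equal sizes are excluded by the gap of 4.\<close>

definition scrA :: "part list set" where
  "scrA = {l. overpartition l \<and>
     (\<forall>p\<in>set l. overlined p \<longrightarrow> odd (psize p)) \<and>
     (\<forall>i j. i < j \<and> j < length l \<longrightarrow>
        psize (l ! i) \<ge> psize (l ! j) + 4 \<and>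
        (overlined (l ! i) \<or> 4 dvd psize (l ! i) \<longrightarrow> psize (l ! i) \<ge> psize (l ! j) + 5))}"

definition scrA_avoid :: "part set \<Rightarrow> part list set" where
  "scrA_avoid S = {l \<in> scrA. \<forall>p\<in>set l. p \<notin> S}"


section \<open>Formal power series in five variables\<close>

text \<open>The ring \<open>\<rat>[[x, y\<^sub>1, y\<^sub>2, z, q]]\<close> is the iterated power series ring
  \<open>\<rat>[[x]][[y\<^sub>1]][[y\<^sub>2]][[z]][[q]]\<close>. Its topology in the library is the \<open>q\<close>-adic one: a family
  is summable with the expected sum iff each coefficient of a power of \<open>q\<close> is a sum that
  eventually stabilises.\<close>

type_synonym series = "rat fps fps fps fps fps"

definition var_x :: series where
  "var_x = fps_const (fps_const (fps_const (fps_const fps_X)))"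

definition var_y1 :: series where
  "var_y1 = fps_const (fps_const (fps_const fps_X))"

definition var_y2 :: series where
  "var_y2 = fps_const (fps_const fps_X)"

definition var_z :: series where
  "var_z = fps_const fps_X"

definition var_q :: series where
  "var_q = fps_X"

definition qpoch :: "'a::comm_ring_1 \<Rightarrow> 'a \<Rightarrow> nat \<Rightarrow> 'a" where
  "qpoch A q n = (\<Prod>k<n. 1 - A * q ^ k)"

definition W :: "part list \<Rightarrow> series" where
  "W l = var_x ^ num_parts l * var_y1 ^ num_parts_cong 2 4 l * var_y2 ^ num_parts_cong 0 4 l *
         var_z ^ num_overlined l * var_q ^ weight_of l"

definition Q :: "nat \<Rightarrow> nat \<Rightarrow> nat \<Rightarrow> nat \<Rightarrow> nat" where
  "Q n1 n2 n3 n4 =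
     4 * (n1 choose 2) + 6 * (n2 choose 2) + 4 * (n3 choose 2) + 8 * (n4 choose 2) +
     4 * n1 * n2 + 4 * n1 * n3 + 4 * n1 * n4 + 4 * n2 * n3 + 4 * n2 * n4 + 4 * n3 * n4"

text \<open>The parameters \<open>b\<^sub>i\<close> are natural numbers, so that the exponents of \<open>q\<close> are too.\<close>

definition S_term :: "nat \<Rightarrow> nat \<Rightarrow> nat \<Rightarrow> nat \<Rightarrow> nat \<times> nat \<times> nat \<times> nat \<Rightarrow> series" where
  "S_term b1 b2 b3 b4 = (\<lambda>(n1, n2, n3, n4).
     (var_x ^ (n1 + n2 + n3 + n4) * var_y1 ^ n3 * var_y2 ^ n4 * var_z ^ n2 *
      var_q ^ (b1 * n1 + b2 * n2 + b3 * n3 + b4 * n4 + Q n1 n2 n3 n4)) /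
     (qpoch (var_q ^ 2) (var_q ^ 2) n1 * qpoch (var_q ^ 2) (var_q ^ 2) n2 *
      qpoch (var_q ^ 4) (var_q ^ 4) n3 * qpoch (var_q ^ 4) (var_q ^ 4) n4))"

definition S :: "nat \<Rightarrow> nat \<Rightarrow> nat \<Rightarrow> nat \<Rightarrow> series" where
  "S b1 b2 b3 b4 = (\<Sum>\<^sub>\<infinity>n\<in>UNIV. S_term b1 b2 b3 b4 n)"


section \<open>The quotients and the infinite sum are genuine\<close>

lemma qpoch_nth_0:
  assumes "m > 0"
  shows "fps_nth (qpoch (var_q ^ m) (var_q ^ m) n) 0 = 1"
  using assms unfolding qpoch_def var_q_def by (induction n) auto

lemma series_divide:
  fixes f g :: series
  assumes "fps_nth g 0 = 1"
  shows "f / g = f * inverse g" and "f / g * g = f"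
proof -
  show eq: "f / g = f * inverse g"
    by (rule fps_divide_unit) (simp add: assms)
  have "inverse g * g = 1"
    using fps_right_inverse[of g "inverse (fps_nth g 0)"]
    by (simp add: assms fps_inverse_def fps_lr_inverse_one_one mult.commute)
  then show "f / g * g = f"
    unfolding eq by (simp add: mult.assoc)
qed

lemma fps_has_sum_nthI:
  fixes f :: "'i \<Rightarrow> 'a::ab_group_add fps"
  assumes fin: "\<And>k. finite {a \<in> A. fps_nth (f a) k \<noteq> 0}"
  shows "(f has_sum Abs_fps (\<lambda>k. \<Sum>a | a \<in> A \<and> fps_nth (f a) k \<noteq> 0. fps_nth (f a) k)) A"
  unfolding has_sum_def
proof (rule tendsto_fpsI)
  fix k
  let ?B = "{a \<in> A. fps_nth (f a) k \<noteq> 0}"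
  show "\<forall>\<^sub>F F in finite_subsets_at_top A. fps_nth (sum f F) k =
          fps_nth (Abs_fps (\<lambda>k. \<Sum>a | a \<in> A \<and> fps_nth (f a) k \<noteq> 0. fps_nth (f a) k)) k"
    unfolding eventually_finite_subsets_at_top
  proof (intro exI[of _ ?B] conjI allI impI)
    show "finite ?B" by (rule fin)
    show "?B \<subseteq> A" by auto
    fix F assume F: "finite F \<and> ?B \<subseteq> F \<and> F \<subseteq> A"
    have "(\<Sum>a\<in>F. fps_nth (f a) k) = (\<Sum>a\<in>?B. fps_nth (f a) k)"
      using F by (intro sum.mono_neutral_right) auto
    then show "fps_nth (sum f F) k =
          fps_nth (Abs_fps (\<lambda>k. \<Sum>a | a \<in> A \<and> fps_nth (f a) k \<noteq> 0. fps_nth (f a) k)) k"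
      by (simp add: fps_sum_nth)
  qed
qed

lemma le_Suc_choose_two: "n \<le> Suc (n choose 2)"
proof (induction n)
  case (Suc n)
  have "Suc n choose 2 = n + (n choose 2)"
    by (simp add: numeral_2_eq_2)
  then show ?case using Suc by (cases n) auto
qed simp

lemma S_term_nth_eq_0:
  assumes "k < Q n1 n2 n3 n4"
  shows "fps_nth (S_term b1 b2 b3 b4 (n1, n2, n3, n4)) k = 0"
proof -
  let ?e = "b1 * n1 + b2 * n2 + b3 * n3 + b4 * n4 + Q n1 n2 n3 n4"
  have nth0: "fps_nth (qpoch (var_q ^ 2) (var_q ^ 2) n1 * qpoch (var_q ^ 2) (var_q ^ 2) n2 *
      qpoch (var_q ^ 4) (var_q ^ 4) n3 * qpoch (var_q ^ 4) (var_q ^ 4) n4) 0 = 1"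
    by (simp add: qpoch_nth_0)
  have move: "a * X * c = (a * c) * X" for a X c :: series
    by (simp add: ac_simps)
  have "\<exists>g. S_term b1 b2 b3 b4 (n1, n2, n3, n4) = g * fps_X ^ ?e"
    unfolding S_term_def prod.case series_divide(1)[OF nth0] unfolding var_q_def
    by (rule exI, rule move)
  then obtain g where g: "S_term b1 b2 b3 b4 (n1, n2, n3, n4) = g * fps_X ^ ?e" ..
  show ?thesis unfolding g using assms by (simp add: fps_X_power_mult_right_nth)
qed

lemma S_term_summable: "S_term b1 b2 b3 b4 summable_on UNIV"
proof -
  have "finite {n \<in> UNIV. fps_nth (S_term b1 b2 b3 b4 n) k \<noteq> 0}" for k
  proof (rule finite_subset)
    show "{n \<in> UNIV. fps_nth (S_term b1 b2 b3 b4 n) k \<noteq> 0} \<subseteq>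
            {..Suc k} \<times> {..Suc k} \<times> {..Suc k} \<times> {..Suc k}"
    proof (clarify, unfold mem_Times_iff fst_conv snd_conv)
      fix n1 n2 n3 n4
      assume "fps_nth (S_term b1 b2 b3 b4 (n1, n2, n3, n4)) k \<noteq> 0"
      then have "Q n1 n2 n3 n4 \<le> k"
        using S_term_nth_eq_0 not_le by blast
      then have "n1 choose 2 \<le> k" "n2 choose 2 \<le> k" "n3 choose 2 \<le> k" "n4 choose 2 \<le> k"
        unfolding Q_def by linarith+
      then show "n1 \<in> {..Suc k} \<and> n2 \<in> {..Suc k} \<and> n3 \<in> {..Suc k} \<and> n4 \<in> {..Suc k}"
        using le_Suc_choose_two[of n1] le_Suc_choose_two[of n2]
          le_Suc_choose_two[of n3] le_Suc_choose_two[of n4] by simp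
    qed
  qed auto
  then show ?thesis
    using fps_has_sum_nthI summable_on_def by blast
qed

end

theory Submission
  imports Defs
begin

text \<open>Let \<open>F\<^sub>1 m, \<dots>, F\<^sub>4 m\<close> be the generating functions of the four families with \<open>4 m\<close> added to
  every part. Splitting off the smallest part expresses each of them linearly
  in terms of the others and of values at \<open>m + 1\<close> and \<open>m + 2\<close>. The quadruple sums satisfy the same
  recurrences: raising one \<open>b\<^sub>i\<close> by the step of the corresponding \<open>q\<close>-Pochhammer symbol
  multiplies each summand by \<open>q\<close> to the power \<open>c n\<^sub>i\<close> (\<open>c = 2\<close> or \<open>4\<close>), and in the difference the
  factor \<open>1 - q^(c n\<^sub>i)\<close> cancels against the denominator. Since every smallest part carries a factor
  \<open>q^(4 m + 1)\<close> and \<open>F\<^sub>1 m \<equiv> 1\<close> modulo \<open>q^(4 m + 1)\<close>, the recurrences have only one solution.\<close>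


section \<open>Infinite sums of formal power series\<close>

text \<open>Makes \<open>has_sum_add\<close> and \<open>has_sum_Un_disjoint\<close> applicable:
  coefficient n of a sum depends only on coefficient n of each summand.\<close>

instance fps :: (ab_group_add) topological_comm_monoid_add
proof
  fix a b :: "'a fps"
  show "LIM x (nhds a \<times>\<^sub>F nhds b). fst x + snd x :> nhds (a + b)"
  proof (rule tendsto_fpsI)
    fix n
    show "\<forall>\<^sub>F x in nhds a \<times>\<^sub>F nhds b. fps_nth (fst x + snd x) n = fps_nth (a + b) n"
      using eventually_prodI[OF eventually_fps_nth_eq_nhds_fps[of n a]
          eventually_fps_nth_eq_nhds_fps[of n b]]
      by eventually_elim simp
  qed
qed

text \<open>Makes \<open>has_sum_cmult_right\<close> applicable. Coefficient n of a product involves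
  only coefficients up to n, so multiplication is continuous.\<close>

instance fps :: (comm_ring_1) topological_semigroup_mult
proof
  fix a b :: "'a fps"
  show "LIM x (nhds a \<times>\<^sub>F nhds b). fst x * snd x :> nhds (a * b)"
  proof (rule tendsto_fpsI)
    fix n
    have eq: "fps_nth (f * g) n = fps_nth (a * b) n"
      if "\<forall>k\<le>n. fps_nth f k = fps_nth a k" "\<forall>k\<le>n. fps_nth g k = fps_nth b k" for f g
      unfolding fps_mult_nth using that by (intro sum.cong) auto
    show "\<forall>\<^sub>F x in nhds a \<times>\<^sub>F nhds b. fps_nth (fst x * snd x) n = fps_nth (a * b) n"
      using eventually_prodI[OF eventually_fps_nth_eq_nhds_fps_strong[of n a]
          eventually_fps_nth_eq_nhds_fps_strong[of n b]]
      by eventually_elim (rule eq; simp)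
  qed
qed

lemma fps_nth_has_sum_singleton:
  fixes f :: "'i \<Rightarrow> 'a::ab_group_add fps"
  assumes "(f has_sum s) A" "a \<in> A" "\<And>b. b \<in> A - {a} \<Longrightarrow> fps_nth (f b) k = 0"
  shows "fps_nth s k = fps_nth (f a) k"
proof -
  have "fps_nth s k = (\<Sum>b | b \<in> A \<and> fps_nth (f b) k \<noteq> 0. fps_nth (f b) k)"
    by (rule has_sum_fpsD(2)[OF assms(1)])
  also have "\<dots> = (\<Sum>b\<in>{a}. fps_nth (f b) k)"
    using assms by (intro sum.mono_neutral_left) auto
  finally show ?thesis by simp
qed

text \<open>The difference \<open>f - f'\<close> is supported on \<open>range h\<close> and equals
  \<open>c * f''\<close> when pulled back along \<open>h\<close>. In the applications
  \<open>h\<close> increments one summation index, and off its range that index is 0.\<close>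

lemma has_sum_plus_reindexed:
  fixes f f' :: "'i \<Rightarrow> 'a::comm_ring_1 fps"
  assumes "(f' has_sum s') UNIV" "(f'' has_sum s'') UNIV" "inj h"
    and "\<And>n. f (h n) = f' (h n) + c * f'' n"
    and "\<And>n. n \<notin> range h \<Longrightarrow> f n = f' n"
  shows "(f has_sum s' + c * s'') UNIV"
proof -
  define g where "g n = f n - f' n" for n
  have "g \<circ> h = (\<lambda>n. c * f'' n)"
    using assms(4) by (auto simp: g_def)
  then have "(g has_sum c * s'') (range h)"
    using has_sum_cmult_right[OF assms(2)] by (simp add: has_sum_reindex[OF assms(3)])
  then have "(g has_sum c * s'') UNIV"
    by (rule has_sum_cong_neutral[THEN iffD1, rotated -1]) (use assms(5) in \<open>auto simp: g_def\<close>)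
  from has_sum_add[OF assms(1) this] show ?thesis
    by (simp add: g_def)
qed


section \<open>The recurrences and their unique solution\<close>

text \<open>The factor \<open>W [p]\<close> records a smallest part \<open>p\<close> that is split
  off. The last two equations each combine two splits. The normalisation of \<open>F1\<close> passes
  to the other functions, because the correction terms are divisible by q^(4m+1).\<close>

definition linked_system ::
  "(nat \<Rightarrow> series) \<Rightarrow> (nat \<Rightarrow> series) \<Rightarrow> (nat \<Rightarrow> series) \<Rightarrow> (nat \<Rightarrow> series) \<Rightarrow> bool" where
  "linked_system F1 F2 F3 F4 \<longleftrightarrow>
     (\<forall>m k. k \<le> 4 * m \<longrightarrow> fps_nth (F1 m) k = fps_nth 1 k) \<and>
     (\<forall>m. F1 m = F2 m + W [overl (4 * m + 1)] * F2 (m + 1)) \<and>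
     (\<forall>m. F2 m = F3 m + W [plain (4 * m + 1)] * F2 (m + 1)) \<and>
     (\<forall>m. F3 m = F4 m + W [overl (4 * m + 3)] * F4 (m + 1) + W [plain (4 * m + 2)] * F3 (m + 1)) \<and>
     (\<forall>m. F4 m = F1 (m + 1) + W [plain (4 * m + 4)] * F1 (m + 2) + W [plain (4 * m + 3)] * F4 (m + 1))"

lemma linked_systemD:
  assumes "linked_system F1 F2 F3 F4"
  shows "k \<le> 4 * m \<Longrightarrow> fps_nth (F1 m) k = fps_nth 1 k"
    and "F1 m = F2 m + W [overl (4 * m + 1)] * F2 (m + 1)"
    and "F2 m = F3 m + W [plain (4 * m + 1)] * F2 (m + 1)"
    and "F3 m = F4 m + W [overl (4 * m + 3)] * F4 (m + 1) + W [plain (4 * m + 2)] * F3 (m + 1)"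
    and "F4 m = F1 (m + 1) + W [plain (4 * m + 4)] * F1 (m + 2) + W [plain (4 * m + 3)] * F4 (m + 1)"
  using assms unfolding linked_system_def by blast+

text \<open>All variables but q lie in the coefficient ring of the outermost series, so
  \<open>W l\<close> is a single monomial in q.\<close>

lemma W_eq_const_mult: "\<exists>c. W l = fps_const c * fps_X ^ weight_of l"
  unfolding W_def var_x_def var_y1_def var_y2_def var_z_def var_q_def
  by simp

lemma W_nth_eq_0: "k \<noteq> weight_of l \<Longrightarrow> fps_nth (W l) k = 0"
  using W_eq_const_mult[of l] by (auto simp: fps_X_power_iff)

text \<open>Multiplication by \<open>W [p]\<close> shifts coefficients by \<open>psize p\<close>;
  for smaller \<open>k\<close> both sides are 0.\<close>

lemma fps_nth_W_single_mult_cong: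
  assumes "psize p \<le> k \<Longrightarrow> fps_nth f (k - psize p) = fps_nth g (k - psize p)"
  shows "fps_nth (W [p] * f) k = fps_nth (W [p] * g) k"
proof -
  obtain c where "W [p] = fps_const c * fps_X ^ psize p"
    using W_eq_const_mult[of "[p]"] by (auto simp: weight_of_def)
  then show ?thesis
    using assms by (auto simp: mult.assoc fps_X_power_mult_nth)
qed

lemma linked_system_unique:
  assumes F: "linked_system F1 F2 F3 F4" and G: "linked_system G1 G2 G3 G4"
  shows "F1 m = G1 m \<and> F2 m = G2 m \<and> F3 m = G3 m \<and> F4 m = G4 m"
proof -
  define agree where "agree k m \<longleftrightarrow> fps_nth (F1 m) k = fps_nth (G1 m) k \<and>
    fps_nth (F2 m) k = fps_nth (G2 m) k \<and> fps_nth (F3 m) k = fps_nth (G3 m) k \<and>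
    fps_nth (F4 m) k = fps_nth (G4 m) k" for k m
  have "agree k m" for k m
  \<comment> \<open>The truncated measure drops when \<open>m\<close> grows and \<open>k\<close>
    does not, provided \<open>4 * m < k\<close>. Otherwise it is already 0: then the
    \<open>W\<close> terms vanish at \<open>k\<close>, and the normalisation settles the
    rest.\<close>
  proof (induction "k - 4 * m" arbitrary: k m rule: less_induct)
    case less
    have IH: "agree k' m'" if "4 * m < k" "k' \<le> k" "m < m'" for k' m'
      using that by (intro less) linarith
    \<comment> \<open>This is the only value at a larger index that enters without a factor
      \<open>W\<close>. At the index \<open>m\<close> itself each function refers only to the next
      one, hence the order \<open>F4\<close>, \<open>F3\<close>, \<open>F2\<close>,
      \<open>F1\<close>.\<close>
    have F1': "fps_nth (F1 (m + 1)) k = fps_nth (G1 (m + 1)) k"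
    proof (cases "k \<le> 4 * m")
      case True
      then have "k \<le> 4 * (m + 1)" by simp
      then show ?thesis
        using linked_systemD(1)[OF F] linked_systemD(1)[OF G] by simp
    next
      case False
      then show ?thesis using IH[of k "m + 1"] by (simp add: agree_def)
    qed
    have W: "fps_nth (W [p] * f m') k = fps_nth (W [p] * g m') k"
      if "4 * m < psize p" "m < m'" "\<And>k'. agree k' m' \<Longrightarrow> fps_nth (f m') k' = fps_nth (g m') k'"
      for p f g m'
      using that by (intro fps_nth_W_single_mult_cong that(3) IH) auto
    have F4: "fps_nth (F4 m) k = fps_nth (G4 m) k"
    proof -
      have "fps_nth (W [plain (4 * m + 4)] * F1 (m + 2)) k = fps_nth (W [plain (4 * m + 4)] * G1 (m + 2)) k"
        "fps_nth (W [plain (4 * m + 3)] * F4 (m + 1)) k = fps_nth (W [plain (4 * m + 3)] * G4 (m + 1)) k"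
        by (rule W; simp add: agree_def)+
      then show ?thesis
        by (simp only: linked_systemD(5)[OF F, of m] linked_systemD(5)[OF G, of m] fps_add_nth F1')
    qed
    have F3: "fps_nth (F3 m) k = fps_nth (G3 m) k"
    proof -
      have "fps_nth (W [overl (4 * m + 3)] * F4 (m + 1)) k = fps_nth (W [overl (4 * m + 3)] * G4 (m + 1)) k"
        "fps_nth (W [plain (4 * m + 2)] * F3 (m + 1)) k = fps_nth (W [plain (4 * m + 2)] * G3 (m + 1)) k"
        by (rule W; simp add: agree_def)+
      then show ?thesis
        by (simp only: linked_systemD(4)[OF F, of m] linked_systemD(4)[OF G, of m] fps_add_nth F4)
    qed
    have F2: "fps_nth (F2 m) k = fps_nth (G2 m) k"
    proof -
      have "fps_nth (W [plain (4 * m + 1)] * F2 (m + 1)) k = fps_nth (W [plain (4 * m + 1)] * G2 (m + 1)) k"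
        by (rule W; simp add: agree_def)
      then show ?thesis
        by (simp only: linked_systemD(3)[OF F, of m] linked_systemD(3)[OF G, of m] fps_add_nth F3)
    qed
    have F1: "fps_nth (F1 m) k = fps_nth (G1 m) k"
    proof -
      have "fps_nth (W [overl (4 * m + 1)] * F2 (m + 1)) k = fps_nth (W [overl (4 * m + 1)] * G2 (m + 1)) k"
        by (rule W; simp add: agree_def)
      then show ?thesis
        by (simp only: linked_systemD(2)[OF F, of m] linked_systemD(2)[OF G, of m] fps_add_nth F2)
    qed
    from F1 F2 F3 F4 show ?case by (simp add: agree_def)
  qed
  then show ?thesis by (auto simp: fps_eq_iff agree_def)
qed


section \<open>The system for overpartitions\<close>

definition gap :: "part \<Rightarrow> part \<Rightarrow> bool" where
  "gap r p \<longleftrightarrow> psize r \<ge> psize p + 4 \<and> (overlined r \<or> 4 dvd psize r \<longrightarrow> psize r \<ge> psize p + 5)"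

definition valid_part :: "part \<Rightarrow> bool" where
  "valid_part p \<longleftrightarrow> psize p > 0 \<and> (overlined p \<longrightarrow> odd (psize p))"

text \<open>A gap of at least 4 forces strictly decreasing sizes, which yields both the ordering and
  the rule that only first occurrences are overlined.\<close>

lemma scrA_iff: "l \<in> scrA \<longleftrightarrow> (\<forall>p\<in>set l. valid_part p) \<and> sorted_wrt gap l"
proof
  assume "l \<in> scrA"
  then show "(\<forall>p\<in>set l. valid_part p) \<and> sorted_wrt gap l"
    by (auto simp: scrA_def overpartition_def valid_part_def gap_def sorted_wrt_iff_nth_less)
next
  assume l: "(\<forall>p\<in>set l. valid_part p) \<and> sorted_wrt gap l"
  then have "psize (l ! j) + 4 \<le> psize (l ! i)" if "i < j" "j < length l" for i j
    using that by (auto simp: gap_def sorted_wrt_iff_nth_less)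
  then have "overpartition l"
    using l unfolding overpartition_def valid_part_def by fastforce
  then show "l \<in> scrA"
    using l by (auto simp: scrA_def valid_part_def gap_def sorted_wrt_iff_nth_less)
qed

text \<open>No part of \<open>A\<close> can follow \<open>p\<close>, since it would have to be
  smaller by at least 4. So \<open>p\<close>, if present, is the last entry, and all other entries
  keep their gap from it.\<close>

lemma scrA_lists_split_min:
  assumes "p \<in> A" "valid_part p" "\<And>r. r \<in> A \<Longrightarrow> psize p \<le> psize r"
  shows "scrA \<inter> lists A =
    scrA \<inter> lists (A - {p}) \<union> (\<lambda>l. l @ [p]) ` (scrA \<inter> lists {r \<in> A. gap r p})" (is "_ = ?B \<union> ?C")
proof
  show "scrA \<inter> lists A \<subseteq> ?B \<union> ?C"
  proof
    fix l assume l: "l \<in> scrA \<inter> lists A"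
    show "l \<in> ?B \<union> ?C"
    proof (cases "p \<in> set l")
      case True
      then obtain us vs where split: "l = us @ p # vs"
        by (meson split_list)
      have "\<not> gap p v" if "v \<in> A" for v
        using assms(3)[OF that] by (auto simp: gap_def)
      with l have "vs = []"
        unfolding split by (cases vs) (auto simp: scrA_iff sorted_wrt_append)
      with l split show ?thesis
        by (auto simp: scrA_iff sorted_wrt_append)
    next
      case False
      with l show ?thesis by auto
    qed
  qed
  show "?B \<union> ?C \<subseteq> scrA \<inter> lists A"
    using assms(1,2) by (auto simp: scrA_iff sorted_wrt_append)
qed

lemma W_Nil [simp]: "W [] = 1"
  by (simp add: W_def num_parts_def num_parts_cong_def num_overlined_def weight_of_def)

lemma W_snoc: "W (l @ [p]) = W [p] * W l"
  by (simp add: W_def num_parts_def num_parts_cong_def num_overlined_def weight_of_def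
      power_add ac_simps)

section \<open>Generating functions over a set of allowed parts\<close>

lemma length_le_weight: "l \<in> scrA \<Longrightarrow> length l \<le> weight_of l"
  unfolding scrA_iff weight_of_def by (induction l) (auto simp: valid_part_def)

lemma psize_le_weight: "p \<in> set l \<Longrightarrow> psize p \<le> weight_of l"
  unfolding weight_of_def by (induction l) auto

lemma finite_scrA_W_nth: "finite {l \<in> scrA \<inter> A. fps_nth (W l) k \<noteq> 0}"
proof (rule finite_subset)
  show "{l \<in> scrA \<inter> A. fps_nth (W l) k \<noteq> 0} \<subseteq> {l. set l \<subseteq> {..k} \<times> UNIV \<and> length l \<le> k}"
  proof clarify
    fix l assume l: "l \<in> scrA" "fps_nth (W l) k \<noteq> 0"
    then have "weight_of l = k"
      using W_nth_eq_0 by metis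
    with l show "set l \<subseteq> {..k} \<times> UNIV \<and> length l \<le> k"
      using length_le_weight[of l] psize_le_weight[of _ l] by force
  qed
qed (intro finite_lists_length_le finite_cartesian_product; simp)

definition gf :: "part set \<Rightarrow> series" where
  "gf A = (\<Sum>\<^sub>\<infinity>l\<in>scrA \<inter> lists A. W l)"

lemma has_sum_gf: "(W has_sum gf A) (scrA \<inter> lists A)"
  unfolding gf_def
  using fps_has_sum_nthI[OF finite_scrA_W_nth] summable_on_def has_sum_infsum by blast

text \<open>Lets sets of parts be described by plain inequalities, whatever they say about
  impossible parts such as overlined even ones.\<close>

lemma scrA_lists_cong:
  assumes "\<And>r. valid_part r \<Longrightarrow> r \<in> A \<longleftrightarrow> r \<in> B"
  shows "scrA \<inter> lists A = scrA \<inter> lists B"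
  using assms by (auto simp: scrA_iff)

text \<open>Sorts the lists by whether the minimal part \<open>p\<close> occurs; \<open>C\<close>
  collects the parts that may stand above \<open>p\<close>.\<close>

lemma gf_split_min:
  assumes "p \<in> A" "valid_part p" "\<And>r. r \<in> A \<Longrightarrow> psize p \<le> psize r"
    and B: "\<And>r. valid_part r \<Longrightarrow> r \<in> B \<longleftrightarrow> r \<in> A \<and> r \<noteq> p"
    and C: "\<And>r. valid_part r \<Longrightarrow> r \<in> C \<longleftrightarrow> r \<in> A \<and> gap r p"
  shows "gf A = gf B + W [p] * gf C"
proof -
  let ?snoc = "\<lambda>l. l @ [p]"
  have B': "scrA \<inter> lists (A - {p}) = scrA \<inter> lists B"
    by (rule scrA_lists_cong) (use B in auto)
  have C': "scrA \<inter> lists {r \<in> A. gap r p} = scrA \<inter> lists C"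
    by (rule scrA_lists_cong) (use C in auto)
  have eq: "scrA \<inter> lists A = scrA \<inter> lists (A - {p}) \<union> ?snoc ` (scrA \<inter> lists C)"
    using scrA_lists_split_min[OF assms(1-3)] unfolding C' .
  have "inj_on ?snoc (scrA \<inter> lists C)"
    by (simp add: inj_on_def)
  moreover have "((W \<circ> ?snoc) has_sum W [p] * gf C) (scrA \<inter> lists C)"
    using has_sum_cmult_right[OF has_sum_gf] by (simp add: o_def W_snoc)
  ultimately have "(W has_sum W [p] * gf C) (?snoc ` (scrA \<inter> lists C))"
    by (simp add: has_sum_reindex)
  \<comment> \<open>Going back from \<open>B\<close> to \<open>A - {p}\<close> makes disjointness
    evident: lists in the image end in \<open>p\<close>.\<close>
  with has_sum_gf[of B] have "(W has_sum gf B + W [p] * gf C) (scrA \<inter> lists A)"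
    unfolding eq B'[symmetric] by (rule has_sum_Un_disjoint) auto
  then show ?thesis
    using has_sum_gf has_sum_unique by blast
qed

lemma gf_nth_low:
  assumes "\<And>p. p \<in> A \<Longrightarrow> k < psize p"
  shows "fps_nth (gf A) k = fps_nth 1 k"
proof -
  have "fps_nth (gf A) k = fps_nth (W []) k"
  proof (rule fps_nth_has_sum_singleton[OF has_sum_gf])
    fix l assume l: "l \<in> scrA \<inter> lists A - {[]}"
    then obtain p where p: "p \<in> set l" "p \<in> A"
      by (cases l) auto
    then have "k \<noteq> weight_of l"
      using assms[of p] psize_le_weight[of p l] by simp
    then show "fps_nth (W l) k = 0"
      by (rule W_nth_eq_0)
  qed (simp add: scrA_iff)
  then show ?thesis by simp
qed

text \<open>This set and the next three contain, at \<open>m = 0\<close>, the parts allowed in the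
  four families of the theorem; a general \<open>m\<close> translates sizes by
  \<open>4 * m\<close>.\<close>

definition parts1 :: "nat \<Rightarrow> part set" where
  "parts1 m = {r. 4 * m < psize r}"

definition parts2 :: "nat \<Rightarrow> part set" where
  "parts2 m = {r. 4 * m < psize r \<and> r \<noteq> overl (4 * m + 1)}"

definition parts3 :: "nat \<Rightarrow> part set" where
  "parts3 m = {r. 4 * m + 1 < psize r}"

definition parts4 :: "nat \<Rightarrow> part set" where
  "parts4 m = {r. 4 * m + 2 < psize r \<and> r \<noteq> overl (4 * m + 3)}"

lemmas parts_defs = parts1_def parts2_def parts3_def parts4_def

text \<open>Above a smallest part a, the next part is at least a + 4, and a + 4 itself is barred if
  overlined or divisible by 4. Hence 4m+1, overlined or not, leads to \<open>parts2 (m + 1)\<close>,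
  and 4m+3 to \<open>parts4 (m + 1)\<close>. The part 4m+2 leads to \<open>parts3 (m + 1)\<close>,
  as 4m+6 cannot be overlined. The part 4m+4 bars 4m+8 and leads to
  \<open>parts1 (m + 2)\<close>.\<close>

lemma linked_system_gf:
  "linked_system (\<lambda>m. gf (parts1 m)) (\<lambda>m. gf (parts2 m)) (\<lambda>m. gf (parts3 m)) (\<lambda>m. gf (parts4 m))"
  unfolding linked_system_def
proof (intro conjI allI impI)
  fix m k :: nat assume "k \<le> 4 * m"
  then show "fps_nth (gf (parts1 m)) k = fps_nth 1 k"
    by (intro gf_nth_low) (auto simp: parts1_def)
next
  fix m
  show "gf (parts1 m) = gf (parts2 m) + W [overl (4 * m + 1)] * gf (parts2 (m + 1))"
    by (rule gf_split_min) (auto simp: parts_defs valid_part_def gap_def; presburger)+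
next
  fix m
  show "gf (parts2 m) = gf (parts3 m) + W [plain (4 * m + 1)] * gf (parts2 (m + 1))"
    by (rule gf_split_min) (auto simp: parts_defs valid_part_def gap_def; presburger)+
next
  fix m
  \<comment> \<open>Intermediate family: first the part 4m+2 is split off, then the overlined
    4m+3.\<close>
  define B where "B = {r. 4 * m + 2 < psize r}"
  have "gf (parts3 m) = gf B + W [plain (4 * m + 2)] * gf (parts3 (m + 1))"
    by (rule gf_split_min) (auto simp: B_def parts_defs valid_part_def gap_def; presburger)+
  moreover have "gf B = gf (parts4 m) + W [overl (4 * m + 3)] * gf (parts4 (m + 1))"
    by (rule gf_split_min) (auto simp: B_def parts_defs valid_part_def gap_def; presburger)+
  ultimately show "gf (parts3 m) = gf (parts4 m) + W [overl (4 * m + 3)] * gf (parts4 (m + 1)) +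
      W [plain (4 * m + 2)] * gf (parts3 (m + 1))"
    by simp
next
  fix m
  \<comment> \<open>Here the plain 4m+3 is split off first, then 4m+4.\<close>
  define B where "B = {r. 4 * m + 3 < psize r}"
  have "gf (parts4 m) = gf B + W [plain (4 * m + 3)] * gf (parts4 (m + 1))"
    by (rule gf_split_min) (auto simp: B_def parts_defs valid_part_def gap_def; presburger)+
  moreover have "gf B = gf (parts1 (m + 1)) + W [plain (4 * m + 4)] * gf (parts1 (m + 2))"
    by (rule gf_split_min) (auto simp: B_def parts_defs valid_part_def gap_def; presburger)+
  ultimately show "gf (parts4 m) = gf (parts1 (m + 1)) + W [plain (4 * m + 4)] * gf (parts1 (m + 2)) +
      W [plain (4 * m + 3)] * gf (parts4 (m + 1))"
    by simp
qed


section \<open>The system for the quadruple sums\<close>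

lemma has_sum_S: "(S_term b1 b2 b3 b4 has_sum S b1 b2 b3 b4) UNIV"
  unfolding S_def by (rule has_sum_infsum[OF S_term_summable])

text \<open>Since \<open>A - B = A * (1 - t)\<close>, the factor \<open>1 - t\<close> cancels
  against the last factor of \<open>E\<close>. In use, \<open>A\<close> and \<open>B\<close> are the
  numerators before and after raising a parameter, and \<open>D\<close> and \<open>E\<close> the
  denominators before and after incrementing the index.\<close>

lemma series_divide_telescope:
  fixes c t N D :: series
  assumes "fps_nth D 0 = 1" "fps_nth t 0 = 0"
    and "A = c * N" "B = A * t" "E = D * (1 - t)"
  shows "A / E = B / E + c * (N / D)"
proof -
  have E0: "fps_nth E 0 = 1"
    using assms by simp
  then have "E \<noteq> 0" by auto
  have "(B / E + c * (N / D)) * E = B / E * E + c * (N / D * D) * (1 - t)"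
    unfolding assms(5) by (simp add: algebra_simps)
  also have "\<dots> = A / E * E"
    unfolding series_divide(2)[OF E0] series_divide(2)[OF assms(1)]
    by (simp add: assms algebra_simps)
  finally show ?thesis
    using \<open>E \<noteq> 0\<close> by simp
qed

section \<open>Parameter shifts in the quadruple sums\<close>

lemma qpoch_Suc: "qpoch A q (Suc n) = qpoch A q n * (1 - A * q ^ n)"
  by (simp add: qpoch_def)

lemma Suc_choose_two: "Suc n choose 2 = n + (n choose 2)"
  by (simp add: numeral_2_eq_2)

text \<open>Incrementing \<open>n1\<close> adds 4(n1 + n2 + n3 + n4) to \<open>Q\<close>, so every
  parameter grows by 4 in the last sum, and b1 n1 contributes \<open>var_q ^ b1\<close>.\<close>

lemma S_raise1:
  "S b1 b2 b3 b4 = S (b1 + 2) b2 b3 b4 + var_x * var_q ^ b1 * S (b1 + 4) (b2 + 4) (b3 + 4) (b4 + 4)"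
proof -
  let ?h = "\<lambda>(n1, n2, n3, n4). (Suc n1, n2, n3, n4)"
  have "(S_term b1 b2 b3 b4 has_sum
      S (b1 + 2) b2 b3 b4 + var_x * var_q ^ b1 * S (b1 + 4) (b2 + 4) (b3 + 4) (b4 + 4)) UNIV"
  proof (rule has_sum_plus_reindexed[OF has_sum_S has_sum_S, of ?h])
    show "inj ?h" by (auto simp: inj_on_def)
  next
    fix n :: "nat \<times> nat \<times> nat \<times> nat"
    obtain n1 n2 n3 n4 where n: "n = (n1, n2, n3, n4)" by (cases n)
    show "S_term b1 b2 b3 b4 (?h n) = S_term (b1 + 2) b2 b3 b4 (?h n) +
        var_x * var_q ^ b1 * S_term (b1 + 4) (b2 + 4) (b3 + 4) (b4 + 4) n"
      unfolding S_term_def n prod.case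
      \<comment> \<open>\<open>t\<close> is the q-power in the new Pochhammer factor at
        \<open>Suc n1\<close>, and also the ratio of the raised to the original numerator.\<close>
      by (rule series_divide_telescope[where t = "var_q ^ (2 + 2 * n1)"])
        (simp add: qpoch_nth_0,
         simp add: var_q_def,
         simp add: Q_def Suc_choose_two ring_distribs power_add ac_simps,
         simp add: Q_def Suc_choose_two algebra_simps flip: power_add,
         simp add: qpoch_Suc ac_simps flip: power_mult power_add)
  next
    fix n :: "nat \<times> nat \<times> nat \<times> nat"
    obtain n1 n2 n3 n4 where n: "n = (n1, n2, n3, n4)" by (cases n)
    assume "n \<notin> range ?h"
    then have "n1 = 0"
      by (cases n1) (auto simp: n image_iff)
    with n show "S_term b1 b2 b3 b4 n = S_term (b1 + 2) b2 b3 b4 n"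
      by (simp add: S_term_def)
  qed
  then show ?thesis using has_sum_S has_sum_unique by blast
qed

text \<open>As for the first index, but 6 binom(n2, 2) grows by 6 n2, hence \<open>b2 + 6\<close>;
  the index \<open>n2\<close> also carries a factor z.\<close>

lemma S_raise2:
  "S b1 b2 b3 b4 = S b1 (b2 + 2) b3 b4 + var_x * var_z * var_q ^ b2 * S (b1 + 4) (b2 + 6) (b3 + 4) (b4 + 4)"
proof -
  let ?h = "\<lambda>(n1, n2, n3, n4). (n1, Suc n2, n3, n4)"
  have "(S_term b1 b2 b3 b4 has_sum
      S b1 (b2 + 2) b3 b4 + var_x * var_z * var_q ^ b2 * S (b1 + 4) (b2 + 6) (b3 + 4) (b4 + 4)) UNIV"
  proof (rule has_sum_plus_reindexed[OF has_sum_S has_sum_S, of ?h])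
    show "inj ?h" by (auto simp: inj_on_def)
  next
    fix n :: "nat \<times> nat \<times> nat \<times> nat"
    obtain n1 n2 n3 n4 where n: "n = (n1, n2, n3, n4)" by (cases n)
    show "S_term b1 b2 b3 b4 (?h n) = S_term b1 (b2 + 2) b3 b4 (?h n) +
        var_x * var_z * var_q ^ b2 * S_term (b1 + 4) (b2 + 6) (b3 + 4) (b4 + 4) n"
      unfolding S_term_def n prod.case
      by (rule series_divide_telescope[where t = "var_q ^ (2 + 2 * n2)"])
        (simp add: qpoch_nth_0,
         simp add: var_q_def,
         simp add: Q_def Suc_choose_two ring_distribs power_add ac_simps,
         simp add: Q_def Suc_choose_two algebra_simps flip: power_add,
         simp add: qpoch_Suc ac_simps flip: power_mult power_add)
  next
    fix n :: "nat \<times> nat \<times> nat \<times> nat"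
    obtain n1 n2 n3 n4 where n: "n = (n1, n2, n3, n4)" by (cases n)
    assume "n \<notin> range ?h"
    then have "n2 = 0"
      by (cases n2) (auto simp: n image_iff)
    with n show "S_term b1 b2 b3 b4 n = S_term b1 (b2 + 2) b3 b4 n"
      by (simp add: S_term_def)
  qed
  then show ?thesis using has_sum_S has_sum_unique by blast
qed

text \<open>The Pochhammer symbol now has base q^4, so the raise is by 4; \<open>Q\<close> changes
  as for the first index.\<close>

lemma S_raise3:
  "S b1 b2 b3 b4 = S b1 b2 (b3 + 4) b4 + var_x * var_y1 * var_q ^ b3 * S (b1 + 4) (b2 + 4) (b3 + 4) (b4 + 4)"
proof -
  let ?h = "\<lambda>(n1, n2, n3, n4). (n1, n2, Suc n3, n4)"
  have "(S_term b1 b2 b3 b4 has_sum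
      S b1 b2 (b3 + 4) b4 + var_x * var_y1 * var_q ^ b3 * S (b1 + 4) (b2 + 4) (b3 + 4) (b4 + 4)) UNIV"
  proof (rule has_sum_plus_reindexed[OF has_sum_S has_sum_S, of ?h])
    show "inj ?h" by (auto simp: inj_on_def)
  next
    fix n :: "nat \<times> nat \<times> nat \<times> nat"
    obtain n1 n2 n3 n4 where n: "n = (n1, n2, n3, n4)" by (cases n)
    show "S_term b1 b2 b3 b4 (?h n) = S_term b1 b2 (b3 + 4) b4 (?h n) +
        var_x * var_y1 * var_q ^ b3 * S_term (b1 + 4) (b2 + 4) (b3 + 4) (b4 + 4) n"
      unfolding S_term_def n prod.case
      by (rule series_divide_telescope[where t = "var_q ^ (4 + 4 * n3)"])
        (simp add: qpoch_nth_0,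
         simp add: var_q_def,
         simp add: Q_def Suc_choose_two ring_distribs power_add ac_simps,
         simp add: Q_def Suc_choose_two algebra_simps flip: power_add,
         simp add: qpoch_Suc ac_simps flip: power_mult power_add)
  next
    fix n :: "nat \<times> nat \<times> nat \<times> nat"
    obtain n1 n2 n3 n4 where n: "n = (n1, n2, n3, n4)" by (cases n)
    assume "n \<notin> range ?h"
    then have "n3 = 0"
      by (cases n3) (auto simp: n image_iff)
    with n show "S_term b1 b2 b3 b4 n = S_term b1 b2 (b3 + 4) b4 n"
      by (simp add: S_term_def)
  qed
  then show ?thesis using has_sum_S has_sum_unique by blast
qed

text \<open>Base q^4 again; 8 binom(n4, 2) grows by 8 n4, hence \<open>b4 + 8\<close>.\<close>

lemma S_raise4:
  "S b1 b2 b3 b4 = S b1 b2 b3 (b4 + 4) + var_x * var_y2 * var_q ^ b4 * S (b1 + 4) (b2 + 4) (b3 + 4) (b4 + 8)"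
proof -
  let ?h = "\<lambda>(n1, n2, n3, n4). (n1, n2, n3, Suc n4)"
  have "(S_term b1 b2 b3 b4 has_sum
      S b1 b2 b3 (b4 + 4) + var_x * var_y2 * var_q ^ b4 * S (b1 + 4) (b2 + 4) (b3 + 4) (b4 + 8)) UNIV"
  proof (rule has_sum_plus_reindexed[OF has_sum_S has_sum_S, of ?h])
    show "inj ?h" by (auto simp: inj_on_def)
  next
    fix n :: "nat \<times> nat \<times> nat \<times> nat"
    obtain n1 n2 n3 n4 where n: "n = (n1, n2, n3, n4)" by (cases n)
    show "S_term b1 b2 b3 b4 (?h n) = S_term b1 b2 b3 (b4 + 4) (?h n) +
        var_x * var_y2 * var_q ^ b4 * S_term (b1 + 4) (b2 + 4) (b3 + 4) (b4 + 8) n"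
      unfolding S_term_def n prod.case
      by (rule series_divide_telescope[where t = "var_q ^ (4 + 4 * n4)"])
        (simp add: qpoch_nth_0,
         simp add: var_q_def,
         simp add: Q_def Suc_choose_two ring_distribs power_add ac_simps,
         simp add: Q_def Suc_choose_two algebra_simps flip: power_add,
         simp add: qpoch_Suc ac_simps flip: power_mult power_add)
  next
    fix n :: "nat \<times> nat \<times> nat \<times> nat"
    obtain n1 n2 n3 n4 where n: "n = (n1, n2, n3, n4)" by (cases n)
    assume "n \<notin> range ?h"
    then have "n4 = 0"
      by (cases n4) (auto simp: n image_iff)
    with n show "S_term b1 b2 b3 b4 n = S_term b1 b2 b3 (b4 + 4) n"
      by (simp add: S_term_def)
  qed
  then show ?thesis using has_sum_S has_sum_unique by blast
qed

text \<open>A nonzero index n_i already puts b_i n_i > k into the exponent of q, which leaves only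
  the summand at the origin.\<close>

lemma S_nth_low:
  assumes "k < b1" "k < b2" "k < b3" "k < b4"
  shows "fps_nth (S b1 b2 b3 b4) k = fps_nth 1 k"
proof -
  have "fps_nth (S b1 b2 b3 b4) k = fps_nth (S_term b1 b2 b3 b4 (0, 0, 0, 0)) k"
  proof (rule fps_nth_has_sum_singleton[OF has_sum_S])
    fix n :: "nat \<times> nat \<times> nat \<times> nat"
    obtain n1 n2 n3 n4 where n: "n = (n1, n2, n3, n4)" by (cases n)
    assume "n \<in> UNIV - {(0, 0, 0, 0)}"
    then have "n1 > 0 \<or> n2 > 0 \<or> n3 > 0 \<or> n4 > 0"
      by (auto simp: n)
    moreover have "k < b * i" if "k < b" "i > 0" for b i :: nat
      using that by (cases i) auto
    ultimately have "k < b1 * n1 \<or> k < b2 * n2 \<or> k < b3 * n3 \<or> k < b4 * n4"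
      using assms by blast
    then have low: "k < b1 * n1 + b2 * n2 + b3 * n3 + b4 * n4 + Q n1 n2 n3 n4"
      by linarith
    have "S_term b1 b2 b3 b4 n =
        var_x ^ (n1 + n2 + n3 + n4) * var_y1 ^ n3 * var_y2 ^ n4 * var_z ^ n2 *
        inverse (qpoch (var_q ^ 2) (var_q ^ 2) n1 * qpoch (var_q ^ 2) (var_q ^ 2) n2 *
          qpoch (var_q ^ 4) (var_q ^ 4) n3 * qpoch (var_q ^ 4) (var_q ^ 4) n4) *
        var_q ^ (b1 * n1 + b2 * n2 + b3 * n3 + b4 * n4 + Q n1 n2 n3 n4)"
      unfolding n S_term_def prod.case
      by (subst series_divide(1)) (simp add: qpoch_nth_0, simp only: ac_simps)
    then show "fps_nth (S_term b1 b2 b3 b4 n) k = 0"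
      using low by (simp add: var_q_def fps_X_power_mult_right_nth)
  qed simp
  also have "S_term b1 b2 b3 b4 (0, 0, 0, 0) = 1"
    using series_divide(2)[of 1 1] by (simp add: S_term_def Q_def qpoch_def binomial_eq_0)
  finally show ?thesis .
qed

lemma W_singleton:
  "odd a \<Longrightarrow> W [plain a] = var_x * var_q ^ a"
  "odd a \<Longrightarrow> W [overl a] = var_x * var_z * var_q ^ a"
  "a mod 4 = 2 \<Longrightarrow> W [plain a] = var_x * var_y1 * var_q ^ a"
  "4 dvd a \<Longrightarrow> W [plain a] = var_x * var_y2 * var_q ^ a"
proof -
  have "a mod 4 \<noteq> 2 \<and> a mod 4 \<noteq> 0" if "odd a"
    using that by presburger
  then show "odd a \<Longrightarrow> W [plain a] = var_x * var_q ^ a"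
    "odd a \<Longrightarrow> W [overl a] = var_x * var_z * var_q ^ a"
    "a mod 4 = 2 \<Longrightarrow> W [plain a] = var_x * var_y1 * var_q ^ a"
    "4 dvd a \<Longrightarrow> W [plain a] = var_x * var_y2 * var_q ^ a"
    by (auto simp: W_def num_parts_def num_parts_cong_def num_overlined_def weight_of_def)
qed

text \<open>Each split of a smallest part corresponds to raising one parameter: the first for plain
  odd parts, the second for overlined ones, the third and fourth for sizes 2 and 0 modulo 4.\<close>

lemma linked_system_S:
  "linked_system
     (\<lambda>m. S (4 * m + 1) (4 * m + 1) (4 * m + 2) (4 * m + 4))
     (\<lambda>m. S (4 * m + 1) (4 * m + 3) (4 * m + 2) (4 * m + 4))
     (\<lambda>m. S (4 * m + 3) (4 * m + 3) (4 * m + 2) (4 * m + 4))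
     (\<lambda>m. S (4 * m + 3) (4 * m + 5) (4 * m + 6) (4 * m + 4))"
  unfolding linked_system_def
proof (intro conjI allI impI)
  fix m k :: nat assume "k \<le> 4 * m"
  then show "fps_nth (S (4 * m + 1) (4 * m + 1) (4 * m + 2) (4 * m + 4)) k = fps_nth 1 k"
    by (intro S_nth_low) auto
next
  fix m
  show "S (4 * m + 1) (4 * m + 1) (4 * m + 2) (4 * m + 4) =
      S (4 * m + 1) (4 * m + 3) (4 * m + 2) (4 * m + 4) + W [overl (4 * m + 1)] *
      S (4 * (m + 1) + 1) (4 * (m + 1) + 3) (4 * (m + 1) + 2) (4 * (m + 1) + 4)"
    using S_raise2[of "4 * m + 1" "4 * m + 1" "4 * m + 2" "4 * m + 4"]
    by (simp add: W_singleton add.commute numeral_3_eq_3)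
next
  fix m
  show "S (4 * m + 1) (4 * m + 3) (4 * m + 2) (4 * m + 4) =
      S (4 * m + 3) (4 * m + 3) (4 * m + 2) (4 * m + 4) + W [plain (4 * m + 1)] *
      S (4 * (m + 1) + 1) (4 * (m + 1) + 3) (4 * (m + 1) + 2) (4 * (m + 1) + 4)"
    using S_raise1[of "4 * m + 1" "4 * m + 3" "4 * m + 2" "4 * m + 4"]
    by (simp add: W_singleton add.commute numeral_3_eq_3)
next
  fix m :: nat
  have "(4 * m + 2) mod 4 = 2" by presburger
  then show "S (4 * m + 3) (4 * m + 3) (4 * m + 2) (4 * m + 4) =
      S (4 * m + 3) (4 * m + 5) (4 * m + 6) (4 * m + 4) + W [overl (4 * m + 3)] *
      S (4 * (m + 1) + 3) (4 * (m + 1) + 5) (4 * (m + 1) + 6) (4 * (m + 1) + 4) +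
      W [plain (4 * m + 2)] *
      S (4 * (m + 1) + 3) (4 * (m + 1) + 3) (4 * (m + 1) + 2) (4 * (m + 1) + 4)"
    \<comment> \<open>The sum with third parameter 4m+6 and second still 4m+3 matches the family of
      parts of size at least 4m+3.\<close>
    using S_raise3[of "4 * m + 3" "4 * m + 3" "4 * m + 2" "4 * m + 4"]
      S_raise2[of "4 * m + 3" "4 * m + 3" "4 * m + 6" "4 * m + 4"]
    by (simp add: W_singleton add.commute)
next
  fix m
  show "S (4 * m + 3) (4 * m + 5) (4 * m + 6) (4 * m + 4) =
      S (4 * (m + 1) + 1) (4 * (m + 1) + 1) (4 * (m + 1) + 2) (4 * (m + 1) + 4) +
      W [plain (4 * m + 4)] *
      S (4 * (m + 2) + 1) (4 * (m + 2) + 1) (4 * (m + 2) + 2) (4 * (m + 2) + 4) +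
      W [plain (4 * m + 3)] *
      S (4 * (m + 1) + 3) (4 * (m + 1) + 5) (4 * (m + 1) + 6) (4 * (m + 1) + 4)"
    \<comment> \<open>The intermediate sum, with fourth parameter still 4m+4, matches the parts of
      size at least 4m+4.\<close>
    using S_raise1[of "4 * m + 3" "4 * m + 5" "4 * m + 6" "4 * m + 4"]
      S_raise4[of "4 * m + 5" "4 * m + 5" "4 * m + 6" "4 * m + 4"]
    by (simp add: W_singleton add.commute)
qed

section \<open>Comparison of the two solutions at index 0\<close>

theorem theorem5p1:
  shows "(W has_sum S 1 1 2 4) scrA \<and>
         (W has_sum S 1 3 2 4) (scrA_avoid {overl 1}) \<and>
         (W has_sum S 3 3 2 4) (scrA_avoid {plain 1, overl 1}) \<and>
         (W has_sum S 3 5 6 4) (scrA_avoid {plain 1, overl 1, plain 2, overl 3})"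
proof -
  have sum: "(W has_sum F) B" if "scrA \<inter> lists A = B" "gf A = F" for A B F
    using that has_sum_gf by blast
  have avoid: "scrA_avoid X = scrA \<inter> lists (- X)" for X
    unfolding scrA_avoid_def by auto
  have eqs: "gf (parts1 0) = S 1 1 2 4" "gf (parts2 0) = S 1 3 2 4"
    "gf (parts3 0) = S 3 3 2 4" "gf (parts4 0) = S 3 5 6 4"
    using linked_system_unique[OF linked_system_gf linked_system_S, of 0]
    by (simp_all add: numeral_2_eq_2)
  have "scrA \<inter> lists (parts1 0) = scrA"
    using scrA_lists_cong[of "parts1 0" UNIV] by (auto simp: valid_part_def parts_defs)
  then have "(W has_sum S 1 1 2 4) scrA"
    by (rule sum[OF _ eqs(1)])
  moreover have "scrA \<inter> lists (parts2 0) = scrA_avoid {overl 1}"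
    unfolding avoid by (rule scrA_lists_cong) (auto simp: valid_part_def parts_defs)
  then have "(W has_sum S 1 3 2 4) (scrA_avoid {overl 1})"
    by (rule sum[OF _ eqs(2)])
  moreover have "scrA \<inter> lists (parts3 0) = scrA_avoid {plain 1, overl 1}"
    unfolding avoid by (rule scrA_lists_cong) (auto simp: valid_part_def parts_defs)
  then have "(W has_sum S 3 3 2 4) (scrA_avoid {plain 1, overl 1})"
    by (rule sum[OF _ eqs(3)])
  \<comment> \<open>\<open>parts4 0\<close> also omits \<open>overl 2\<close>, which is not a valid
    part because its size is even.\<close>
  moreover have "scrA \<inter> lists (parts4 0) = scrA_avoid {plain 1, overl 1, plain 2, overl 3}"
    unfolding avoid
    by (rule scrA_lists_cong) (auto simp: valid_part_def parts_defs; presburger)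
  then have "(W has_sum S 3 5 6 4) (scrA_avoid {plain 1, overl 1, plain 2, overl 3})"
    by (rule sum[OF _ eqs(4)])
  ultimately show ?thesis by blast
qed

end
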